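(* Let $h:\mathbb{R}_+^n\times\mathbb{R}\to\mathbb{R}_+\cup\{\infty\}$ be a function satisfying all of the following properties. (i) (Positive-homogeneity in $x$) For all $x\in\mathbb{R}_+^n$, $y\in\mathbb{R}$ and $\alpha>0$, $h(\alpha x,y)=\alpha\,h(x,y)$. (ii) (Monotonicity) For all $x,x'\in\mathbb{R}_+^n$ and $y,y'\in\mathbb{R}$: if $x\le x'$ then $h(x,y)\le h(x',y)$; and if $y\le y'$ then $h(x,y')\le h(x,y)$. (iii) (Right-continuity in $y$) For all $x\in\mathbb{R}_+^n$ and $y\in\mathbb{R}$, $\lim_{\epsilon\downarrow 0}h(x,y+\epsilon)=h(x,y)$. (iv) (Well-posedness) For all $x\in\mathbb{R}_+^n$ there exist $y,y'\in\mathbb{R}$ with $y>y'$ such that $h(x,y)\le 1$ and $h(x,y')>1$. Then there exists an increasing function $g:\mathbb{R}_+^n\to\mathbb{R}$ such that $h=\rho_g$, i.e. $h(x,y)=\inf\{r>0: g(x/r)\le y\}$ for all $(x,y)\in\mathbb{R}_+^n\times\mathbb{R}$.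
   Context: $\mathbb{R}_+:=[0,\infty)$. For vectors $x,x'\in\mathbb{R}^n$, $x\le x'$ means $x_i\le x'_i$ for all $i\in\{1,\dots,n\}$. A function $g:\mathbb{R}_+^n\to\mathbb{R}$ is increasing if $g(x)\le g(x')$ whenever $x\le x'$. For an increasing $g$, its radial inverse $\rho_g:\mathbb{R}_+^n\times\mathbb{R}\to\mathbb{R}_+\cup\{\infty\}$ is $\rho_g(x,y):=\inf\{r>0: g(x/r)\le y\}$, with $\inf\emptyset=\infty$. Order, limits and multiplication by $\alpha>0$ in $[0,\infty]$ are understood in the extended sense (in particular $\alpha\cdot\infty=\infty$). *)

theory Defs
  imports "HOL-Analysis.Analysis"
begin

text \<open>
  The nonnegative orthant is \<open>{0..}\<close>, for the componentwise order on \<open>real ^ 'n\<close>. Functions on the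
  orthant are total functions whose values off the orthant are irrelevant. The value set
  \<open>[0,\<infinity>]\<close> is \<open>ennreal\<close>, where the infimum of the empty set is \<open>\<infinity>\<close>.
\<close>

definition radial_inverse :: "(real ^ 'n \<Rightarrow> real) \<Rightarrow> real ^ 'n \<Rightarrow> real \<Rightarrow> ennreal" where
  "radial_inverse g x y = Inf {ennreal r | r. r > 0 \<and> g (x /\<^sub>R r) \<le> y}"

end

theory Submission
  imports Defs
begin

text \<open>
  The function \<open>g x = Inf {y. h x y \<le> 1}\<close> works. Right-continuity makes the infimum a minimum, so
  \<open>g x \<le> y\<close> iff \<open>h x y \<le> 1\<close>. Homogeneity then turns \<open>g (x / r) \<le> y\<close> into \<open>h x y \<le> r\<close>, and
  \<open>h x y\<close> is the infimum of the positive reals above it.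
\<close>

text \<open>The order on \<open>ennreal\<close> is dense: any \<open>d\<close> above
  \<open>c\<close> leaves room for some \<open>e\<close> strictly between, which is finite because
  \<open>e < d\<close> and positive because \<open>c < e\<close>. This also covers
  \<open>c = 0\<close>, where the infimum is not attained, and \<open>c = \<infinity>\<close>, where
  the set is empty.\<close>

lemma Inf_positive_reals_above:
  fixes c :: ennreal
  shows "Inf {ennreal r | r. r > 0 \<and> c \<le> ennreal r} = c"
proof (rule antisym)
  show "c \<le> Inf {ennreal r | r. r > 0 \<and> c \<le> ennreal r}"
    by (rule Inf_greatest) auto
  show "Inf {ennreal r | r. r > 0 \<and> c \<le> ennreal r} \<le> c"
  proof (rule dense_ge)
    fix d assume "c < d"
    then obtain e where e: "c < e" "e < d"
      using dense by blast
    then obtain r where r: "r \<ge> 0" "e = ennreal r"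
      by (cases e) auto
    have "r > 0"
      using e(1) r by (cases "r = 0") auto
    then have "Inf {ennreal r | r. r > 0 \<and> c \<le> ennreal r} \<le> e"
      using e(1) r by (intro Inf_lower) auto
    then show "Inf {ennreal r | r. r > 0 \<and> c \<le> ennreal r} \<le> d"
      using e(2) by simp
  qed
qed

text \<open>The points \<open>a\<close> and \<open>b\<close> make the sublevel set nonempty and
  bounded below, so its real infimum is meaningful. By antitonicity the set is an upward ray, and
  right-continuity puts its endpoint into it.\<close>

lemma Inf_sublevel_le_iff:
  fixes f :: "real \<Rightarrow> ennreal"
  assumes "antimono f"
    and right_continuous: "((\<lambda>\<epsilon>. f (y + \<epsilon>)) \<longlongrightarrow> f y) (at_right 0)"
    and "f a \<le> c" "c < f b"
  shows "Inf {z. f z \<le> c} \<le> y \<longleftrightarrow> f y \<le> c"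
proof
  have bdd: "bdd_below {z. f z \<le> c}"
  proof (rule bdd_belowI)
    fix z assume z: "z \<in> {z. f z \<le> c}"
    show "b \<le> z"
    proof (rule ccontr)
      assume "\<not> b \<le> z"
      then have "f b \<le> f z"
        using antimonoD[OF \<open>antimono f\<close>] by simp
      then show False
        using z \<open>c < f b\<close> by auto
    qed
  qed
  show "Inf {z. f z \<le> c} \<le> y" if "f y \<le> c"
    using that bdd by (intro cInf_lower) auto
  assume le: "Inf {z. f z \<le> c} \<le> y"
  \<comment> \<open>Strictly to the right of the infimum, every point lies above some member of the
    sublevel set; the bound then survives the limit \<epsilon> to 0 from the right.\<close>
  have "f (y + \<epsilon>) \<le> c" if "\<epsilon> > 0" for \<epsilon>
  proof -
    have "Inf {z. f z \<le> c} < y + \<epsilon>"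
      using le that by simp
    then obtain z where "f z \<le> c" "z < y + \<epsilon>"
      using cInf_lessD[of "{z. f z \<le> c}"] \<open>f a \<le> c\<close> by blast
    then show ?thesis
      using antimonoD[OF \<open>antimono f\<close>, of z "y + \<epsilon>"] by simp
  qed
  then have "\<forall>\<^sub>F \<epsilon> in at_right 0. f (y + \<epsilon>) \<le> c"
    by (intro eventually_at_right_less[THEN eventually_mono]) auto
  then show "f y \<le> c"
    by (intro tendsto_upperbound[OF right_continuous]) auto
qed

theorem proposition3:
  fixes h :: "real ^ 'n \<Rightarrow> real \<Rightarrow> ennreal"
  assumes homogeneous:
      "\<And>x y \<alpha>. x \<in> {0..} \<Longrightarrow> \<alpha> > 0 \<Longrightarrow> h (\<alpha> *\<^sub>R x) y = ennreal \<alpha> * h x y"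
    and mono:
      "\<And>x x' y. x \<in> {0..} \<Longrightarrow> x' \<in> {0..} \<Longrightarrow> x \<le> x' \<Longrightarrow> h x y \<le> h x' y"
    and antimono:
      "\<And>x y y'. x \<in> {0..} \<Longrightarrow> y \<le> y' \<Longrightarrow> h x y' \<le> h x y"
    and right_continuous:
      "\<And>x y. x \<in> {0..} \<Longrightarrow> ((\<lambda>\<epsilon>. h x (y + \<epsilon>)) \<longlongrightarrow> h x y) (at_right 0)"
    and well_posed:
      "\<And>x. x \<in> {0..} \<Longrightarrow> \<exists>y y'. y > y' \<and> h x y \<le> 1 \<and> h x y' > 1"
  shows "\<exists>g :: real ^ 'n \<Rightarrow> real.
           mono_on {0..} g \<and> (\<forall>x\<in>{0..}. \<forall>y. h x y = radial_inverse g x y)"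
proof (intro exI conjI ballI allI)
  define g where "g x = Inf {y. h x y \<le> 1}" for x
  have g_le_iff: "g x \<le> y \<longleftrightarrow> h x y \<le> 1" if x: "x \<in> {0..}" for x y
  proof -
    obtain a b where "h x a \<le> 1" "1 < h x b"
      using well_posed[OF x] by blast
    then show ?thesis
      unfolding g_def
      using antimono[OF x] right_continuous[OF x] by (intro Inf_sublevel_le_iff antimonoI)
  qed
  show "mono_on {0..} g"
  proof (rule mono_onI)
    fix x x' :: "real ^ 'n"
    assume x: "x \<in> {0..}" "x' \<in> {0..}" "x \<le> x'"
    \<comment> \<open>The infimum defining \<open>g x'\<close> is attained: this is
      \<open>g_le_iff\<close> at \<open>y = g x'\<close>.\<close>
    have "h x' (g x') \<le> 1"
      using g_le_iff[OF x(2)] by blast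
    then have "h x (g x') \<le> 1"
      using mono[OF x] order_trans by blast
    then show "g x \<le> g x'"
      using g_le_iff[OF x(1)] by blast
  qed
  fix x :: "real ^ 'n" and y
  assume x: "x \<in> {0..}"
  have "g (x /\<^sub>R r) \<le> y \<longleftrightarrow> h x y \<le> ennreal r" if r: "r > 0" for r
  proof -
    have xr: "x /\<^sub>R r \<in> {0..}"
      using x r by (auto intro!: scaleR_nonneg_nonneg)
    \<comment> \<open>Homogeneity is used with both factors \<open>inverse r\<close> and
      \<open>r\<close>, so each direction below is a monotone multiplication, valid also when
      \<open>h x y\<close> is infinite.\<close>
    have down: "h (x /\<^sub>R r) y = ennreal (inverse r) * h x y"
      using homogeneous[OF x, of "inverse r"] r by simp
    have up: "h x y = ennreal r * h (x /\<^sub>R r) y"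
      using homogeneous[OF xr r] r by simp
    have cancel: "ennreal (inverse r) * ennreal r = 1"
      using r by (simp flip: ennreal_mult)
    have "h (x /\<^sub>R r) y \<le> 1 \<longleftrightarrow> h x y \<le> ennreal r"
    proof
      show "h x y \<le> ennreal r" if "h (x /\<^sub>R r) y \<le> 1"
        using mult_left_mono[OF that, of "ennreal r"] up by simp
      show "h (x /\<^sub>R r) y \<le> 1" if "h x y \<le> ennreal r"
        using mult_left_mono[OF that, of "ennreal (inverse r)"] down cancel by simp
    qed
    then show ?thesis
      using g_le_iff[OF xr] by simp
  qed
  then have "{ennreal r | r. r > 0 \<and> g (x /\<^sub>R r) \<le> y} = {ennreal r | r. r > 0 \<and> h x y \<le> ennreal r}"
    by blast
  then show "h x y = radial_inverse g x y"
    by (simp add: radial_inverse_def Inf_positive_reals_above)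
qed

end
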